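(* (a) $\tau_d$ is stochastically increasing in $d\ge1$: for all integers $d\ge 1$ and $n\ge1$, $\mathbb{P}(\tau_{d+1}\le n)\le\mathbb{P}(\tau_d\le n)$. (b) For every $d\ge1$, $\tau_d$ is stochastically larger than $T^{\mathbf{h}}$ for every $d$-dimensional probability vector $\mathbf{h}\ne(\frac1d,\dots,\frac1d)$: $\mathbb{P}(\tau_d\le n)\le\mathbb{P}(T^{\mathbf{h}}\le n)$ for all integers $n\ge1$.
   Context: A vector $\mathbf{h}=(h_1,\dots,h_d)\in\mathbb{R}^d$ is a probability vector if $h_i\ge 0$ for all $i$ and $h_1+\cdots+h_d=1$. Let $\mathbf{0}_d$ be the zero vector and $\mathbf{e}_d^i$ the $i$-th standard unit vector of $\mathbb{Z}^d$. For a probability vector $\mathbf{h}=(h_1,\dots,h_d)$, $(S^{\mathbf{h}}_n)_{n\ge 0}$ is the random walk on $\mathbb{Z}^d$ with $S^{\mathbf{h}}_0=\mathbf{0}_d$ and $S^{\mathbf{h}}_n=X^{\mathbf{h}}_1+\cdots+X^{\mathbf{h}}_n$ for $n\ge1$, where the increments $X^{\mathbf{h}}_n$ are i.i.d. with $\mathbb{P}(X^{\mathbf{h}}_n=\mathbf{e}_d^i)=\mathbb{P}(X^{\mathbf{h}}_n=-\mathbf{e}_d^i)=\frac12 h_i$ for $i=1,\dots,d$. The first return time is $T^{\mathbf{h}}=\inf\{n\geq 1: S^{\mathbf{h}}_n=\mathbf{0}_d\}$ (with $\inf\emptyset=\infty$). $\tau_d$ denotes the first return time to its starting point of the $d$-dimensional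 simple random walk, i.e. $\tau_d=T^{\mathbf{h}}$ for $\mathbf{h}=(\frac1d,\dots,\frac1d)$ ($d$ entries). *)

theory Defs
  imports "HOL-Probability.Probability"
begin

text \<open>
  Since the dimension varies inside the statement, a point of the \<open>d\<close>-dimensional integer lattice
  is a function \<open>nat \<Rightarrow> int\<close> vanishing outside the coordinates \<open>1, \<dots>, d\<close>. A vector of \<open>d\<close> reals is
  a function \<open>nat \<Rightarrow> real\<close> of which only the values on \<open>{1..d}\<close> matter.
\<close>

definition lattice :: "nat \<Rightarrow> (nat \<Rightarrow> int) set" where
  "lattice d = {x. \<forall>i. i \<notin> {1..d} \<longrightarrow> x i = 0}"

definition zero_vec :: "nat \<Rightarrow> int" where
  "zero_vec = (\<lambda>j. 0)"

definition unit_vec :: "nat \<Rightarrow> nat \<Rightarrow> int" where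
  "unit_vec i = (\<lambda>j. if j = i then 1 else 0)"

definition prob_vector :: "nat \<Rightarrow> (nat \<Rightarrow> real) \<Rightarrow> bool" where
  "prob_vector d h \<longleftrightarrow> (\<forall>i\<in>{1..d}. 0 \<le> h i) \<and> (\<Sum>i=1..d. h i) = 1"

definition uniform_vector :: "nat \<Rightarrow> nat \<Rightarrow> real" where
  "uniform_vector d = (\<lambda>i. 1 / real d)"

text \<open>
  \<open>walk_increments M d h X\<close>: on the probability space \<open>M\<close>, the family \<open>X 1, X 2, \<dots>\<close> is an
  independent sequence of lattice-valued random variables, each with the step distribution given
  by \<open>h\<close>. For a probability vector \<open>h\<close> the listed probabilities add up to \<open>1\<close>, so they determine
  the common law. \<open>X 0\<close> plays no role.
\<close>

definition walk_increments ::
    "'a measure \<Rightarrow> nat \<Rightarrow> (nat \<Rightarrow> real) \<Rightarrow> (nat \<Rightarrow> 'a \<Rightarrow> nat \<Rightarrow> int) \<Rightarrow> bool" where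
  "walk_increments M d h X \<longleftrightarrow>
     prob_space M \<and>
     prob_space.indep_vars M (\<lambda>_. count_space (lattice d)) X {1..} \<and>
     (\<forall>k\<ge>1. \<forall>i\<in>{1..d}.
        measure M {\<omega> \<in> space M. X k \<omega> = unit_vec i} = h i / 2 \<and>
        measure M {\<omega> \<in> space M. X k \<omega> = (\<lambda>j. - unit_vec i j)} = h i / 2)"

definition walk :: "(nat \<Rightarrow> 'a \<Rightarrow> nat \<Rightarrow> int) \<Rightarrow> nat \<Rightarrow> 'a \<Rightarrow> nat \<Rightarrow> int" where
  "walk X n \<omega> = (\<lambda>j. \<Sum>k=1..n. X k \<omega> j)"

text \<open>The infimum is taken in \<^typ>\<open>enat\<close>, where \<open>Inf {} = \<infinity>\<close>.\<close>

definition return_time :: "(nat \<Rightarrow> 'a \<Rightarrow> nat \<Rightarrow> int) \<Rightarrow> 'a \<Rightarrow> enat" where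
  "return_time X \<omega> = Inf {enat n | n. 1 \<le> n \<and> walk X n \<omega> = zero_vec}"

lemma prob_vector_uniform: "1 \<le> d \<Longrightarrow> prob_vector d (uniform_vector d)"
  by (simp add: prob_vector_def uniform_vector_def)

lemma indep_vars_PiM_components:
  assumes "\<And>i. prob_space (P i)"
  shows "prob_space.indep_vars (PiM UNIV P) P (\<lambda>i \<omega>. \<omega> i) UNIV"
proof -
  interpret prob_space "PiM UNIV P" by (rule prob_space_PiM) (use assms in auto)
  have 1: "distr (PiM UNIV P) (P i) (\<lambda>\<omega>. \<omega> i) = P i" for i
    by (rule distr_PiM_component) (use assms in auto)
  have 2: "distr (PiM UNIV P) (PiM UNIV P) (\<lambda>x. x) = PiM UNIV P"
    by (rule distr_id2) simp
  show ?thesis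
    by (subst indep_vars_iff_distr_eq_PiM) (simp_all add: 1 2 restrict_def)
qed

text \<open>Such increments exist, i.e. \<^const>\<open>walk_increments\<close> is satisfiable.\<close>

lemma walk_increments_exist:
  assumes h: "prob_vector d h"
  shows "\<exists>(M :: (nat \<Rightarrow> nat \<times> bool) measure) X. walk_increments M d h X"
proof -
  define f where "f i = (if i \<in> {1..d} then h i else 0)" for i
  have f0: "0 \<le> f i" for i using h by (auto simp: f_def prob_vector_def)
  have "(\<integral>\<^sup>+ i. ennreal (f i) \<partial>count_space UNIV) = (\<Sum>i\<in>{1..d}. ennreal (f i))"
    by (rule nn_integral_count_space') (auto simp: f_def)
  also have "\<dots> = ennreal (\<Sum>i\<in>{1..d}. f i)" using f0 by (simp add: sum_ennreal)
  also have "(\<Sum>i\<in>{1..d}. f i) = (\<Sum>i\<in>{1..d}. h i)"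
    by (rule sum.cong) (auto simp: f_def)
  also have "\<dots> = 1" using h by (simp add: prob_vector_def)
  finally have f1: "(\<integral>\<^sup>+ i. ennreal (f i) \<partial>count_space UNIV) = 1" by simp
  define q where "q = embed_pmf f"
  have q: "pmf q i = f i" for i unfolding q_def by (rule pmf_embed_pmf[OF f0 f1])
  define p where "p = pair_pmf q (bernoulli_pmf (1/2))"
  have p: "pmf p (i, b) = f i / 2" for i b by (cases b) (simp_all add: p_def pmf_pair q)
  define g :: "nat \<times> bool \<Rightarrow> nat \<Rightarrow> int" where
    "g = (\<lambda>(i, b) j. if i \<in> {1..d} then (if b then unit_vec i j else - unit_vec i j) else 0)"
  have gL: "g y \<in> lattice d" for y by (auto simp: g_def lattice_def unit_vec_def split: prod.splits)
  define M where "M = PiM UNIV (\<lambda>_::nat. measure_pmf p)"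
  interpret M: prob_space M unfolding M_def by (rule prob_space_PiM) (rule prob_space_measure_pmf)
  have ind: "M.indep_vars (\<lambda>_. count_space (lattice d)) (\<lambda>k \<omega>. g (\<omega> k)) UNIV"
  proof (rule M.indep_vars_compose2)
    show "M.indep_vars (\<lambda>_. measure_pmf p) (\<lambda>i \<omega>. \<omega> i) UNIV"
      unfolding M_def by (rule indep_vars_PiM_components) (rule prob_space_measure_pmf)
    show "g \<in> measurable (measure_pmf p) (count_space (lattice d))"
      using gL by (auto simp: measurable_def)
  qed
  have meas: "measure M {\<omega> \<in> space M. g (\<omega> k) = v} = measure p {y. g y = v}" for k v
  proof -
    have "distr M (measure_pmf p) (\<lambda>\<omega>. \<omega> k) = measure_pmf p"
      unfolding M_def by (rule distr_PiM_component) (auto intro: prob_space_measure_pmf)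
    then have "measure p {y. g y = v} = measure (distr M (measure_pmf p) (\<lambda>\<omega>. \<omega> k)) {y. g y = v}"
      by simp
    also have "\<dots> = measure M ((\<lambda>\<omega>. \<omega> k) -` {y. g y = v} \<inter> space M)"
      by (rule measure_distr) (simp_all add: M_def)
    finally show ?thesis by (simp add: vimage_def Int_def conj_commute)
  qed
  have eqs: "{y. g y = unit_vec i} = {(i, True)}"
            "{y. g y = (\<lambda>j. - unit_vec i j)} = {(i, False)}" if i: "i \<in> {1..d}" for i
  proof -
    have a: "y = (i, True)" if "g y = unit_vec i" for y
      using fun_cong[OF that, of i] by (auto simp: g_def unit_vec_def split: prod.splits if_splits)
    have b: "y = (i, False)" if "g y = (\<lambda>j. - unit_vec i j)" for y
      using fun_cong[OF that, of i] by (auto simp: g_def unit_vec_def split: prod.splits if_splits)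
    have c: "g (i, True) = unit_vec i" "g (i, False) = (\<lambda>j. - unit_vec i j)"
      using i by (auto simp: g_def)
    show "{y. g y = unit_vec i} = {(i, True)}"
      using a c(1) by blast
    show "{y. g y = (\<lambda>j. - unit_vec i j)} = {(i, False)}"
      using b c(2) by blast
  qed
  have "walk_increments M d h (\<lambda>k \<omega>. g (\<omega> k))"
    unfolding walk_increments_def
    using M.prob_space_axioms M.indep_vars_subset[OF ind, of "{1..}"]
    by (auto simp: meas eqs measure_pmf_single p f_def)
  then show ?thesis by blast
qed

end

theory Submission
  imports Defs
begin

text \<open>
  Let \<open>U\<^bsub>h\<^esub>(z) = \<Sum>\<^sub>n P(S\<^sub>n = 0) z\<^sup>n\<close> be the generating function of the return probabilities of the walk with
  direction probabilities \<open>h\<close>. The proof compares two walks through the coefficients of the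
  quotient \<open>K = U\<^bsub>h\<^esub> / U\<^bsub>h'\<^esub>\<close>. Since the tails of the return time have generating function
  \<open>1 / ((1 - z) U\<^bsub>h\<^esub>)\<close>, one has \<open>P(T\<^bsub>h'\<^esub> > n) = \<Sum>\<^sub>i K\<^sub>i P(T\<^bsub>h\<^esub> > n - i)\<close>; as \<open>K\<^sub>0 = 1\<close>, nonnegativity of all \<open>K\<^sub>i\<close>
  makes \<open>T\<^bsub>h'\<^esub>\<close> stochastically larger than \<open>T\<^bsub>h\<^esub>\<close> (lemma \<open>returned_mono\<close>). Nonnegativity of the
  quotient is transitive, so it suffices to prove it when \<open>h'\<close> arises from \<open>h\<close> by moving weight from a
  coordinate \<open>a\<close> to a coordinate \<open>b\<close> such that \<open>h\<^sub>a h\<^sub>b\<close> does not decrease (lemma \<open>dominates_transfer\<close>).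
  Finitely many such moves turn any probability vector into the uniform one. The comparison of the
  dimensions \<open>d\<close> and \<open>d + 1\<close> is the case \<open>h = (1/d, \<dots>, 1/d, 0)\<close>.

  For a single move, tell each step along \<open>a\<close> or \<open>b\<close> only up to its sign, and decide afterwards by
  independent coins, with probabilities \<open>\<alpha> = h\<^sub>a / (h\<^sub>a + h\<^sub>b)\<close> and \<open>\<beta> = 1 - \<alpha>\<close>, which of the two coordinates
  it uses. If there are \<open>m\<close> positive and \<open>m\<close> negative such steps, both coordinates return to zero with the
  probability \<open>c(m) = \<Sum>\<^sub>j (binom(m,j) \<alpha>\<^sup>j \<beta>\<^bsup>m-j\<^esup>)\<^sup>2\<close> that two independent binomial variables agree. The series
  \<open>\<Sum>\<^sub>m c(m) z\<^sup>m\<close> is \<open>((1 - z)(1 - p z))\<^bsup>-1/2\<^esup>\<close> with \<open>p = (\<alpha> - \<beta>)\<^sup>2\<close>, so \<open>c\<close> is the convolution of the corresponding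
  sequence \<open>c'\<close> of \<open>h'\<close> with a nonnegative sequence \<open>\<kappa>\<close> (lemma \<open>collision_prob_convolution\<close>).

  Hence \<open>U\<^bsub>h\<^esub> = \<Sum>\<^sub>i \<kappa>\<^sub>i G\<^sub>i\<close>, where \<open>G\<^sub>i\<close> has the coefficients \<open>\<Sum>\<^sub>m c'(m - i) t(n, m)\<close>, with \<open>t(n, m)\<close> the
  probability that \<open>n\<close> steps contain \<open>m\<close> steps of either sign along \<open>a\<close> and \<open>b\<close> and are balanced in the
  remaining coordinates. This \<open>G\<^sub>i\<close> has a meaning for the walk \<open>h'\<close>: it is the generating function of the event
  that the walk is back at zero when the coins of the first \<open>i\<close> positive and the first \<open>i\<close> negative steps
  along \<open>a\<close> and \<open>b\<close> are ignored. Such events form a delayed renewal process: once the event has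
  occurred, it occurs again exactly when the subsequent path is a closed loop. Therefore \<open>G\<^sub>i = R\<^sub>i U\<^bsub>h'\<^esub>\<close>, where the
  coefficients of \<open>R\<^sub>i\<close> are the probabilities of a first occurrence, and \<open>K = \<Sum>\<^sub>i \<kappa>\<^sub>i R\<^sub>i\<close> is nonnegative.

  All probabilities are computed as weighted sums over finite lists of steps.
\<close>

unbundle no vec_syntax
unbundle fps_syntax

section \<open>Weighted sums over lists of steps\<close>

text \<open>
  A sum over lists of length \<open>n\<close>, each weighted by the product of its letters (lemma \<open>mass_eq_sum_lists\<close>).
  The recursion on the first letter shifts the predicate, so inductions on \<open>n\<close> generalise over \<open>P\<close>.
\<close>

primrec mass :: "'s set \<Rightarrow> ('s \<Rightarrow> real) \<Rightarrow> nat \<Rightarrow> ('s list \<Rightarrow> bool) \<Rightarrow> real" where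
  "mass A w 0 P = of_bool (P [])"
| "mass A w (Suc n) P = (\<Sum>s\<in>A. w s * mass A w n (\<lambda>xs. P (s # xs)))"

lemma mass_cong:
  assumes "\<And>xs. set xs \<subseteq> A \<Longrightarrow> length xs = n \<Longrightarrow> P xs = Q xs"
  shows "mass A w n P = mass A w n Q"
  using assms
proof (induction n arbitrary: P Q)
  case (Suc n)
  have "mass A w n (\<lambda>xs. P (s # xs)) = mass A w n (\<lambda>xs. Q (s # xs))" if "s \<in> A" for s
    by (rule Suc.IH) (use that Suc.prems in simp)
  then show ?case by (simp cong: sum.cong)
qed simp

lemma mass_weight_cong: "(\<And>s. s \<in> A \<Longrightarrow> w s = w' s) \<Longrightarrow> mass A w n P = mass A w' n P"
  by (induction n arbitrary: P) (simp_all cong: sum.cong)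

lemma mass_False: "mass A w n (\<lambda>_. False) = 0"
  by (induction n) simp_all

lemma mass_True: "sum w A = 1 \<Longrightarrow> mass A w n (\<lambda>_. True) = 1"
  by (induction n) simp_all

lemma mass_nonneg: "(\<And>s. s \<in> A \<Longrightarrow> 0 \<le> w s) \<Longrightarrow> 0 \<le> mass A w n P"
  by (induction n arbitrary: P) (auto intro!: sum_nonneg)

lemma mass_mono:
  assumes "\<And>s. s \<in> A \<Longrightarrow> 0 \<le> w s" and "\<And>xs. P xs \<Longrightarrow> Q xs"
  shows "mass A w n P \<le> mass A w n Q"
  using assms(2)
proof (induction n arbitrary: P Q)
  case (Suc n)
  show ?case
    using Suc.prems assms(1) by (auto intro!: sum_mono mult_left_mono Suc.IH)
qed auto

lemma mass_partition:
  assumes "finite J" and "\<And>xs. length xs = n \<Longrightarrow> P xs \<Longrightarrow> f xs \<in> J"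
  shows "mass A w n P = (\<Sum>j\<in>J. mass A w n (\<lambda>xs. P xs \<and> f xs = j))"
  using assms(2)
proof (induction n arbitrary: P f)
  case 0
  then show ?case using assms(1) by (cases "P []") (simp_all add: of_bool_def)
next
  case (Suc n)
  have "mass A w n (\<lambda>xs. P (s # xs)) = (\<Sum>j\<in>J. mass A w n (\<lambda>xs. P (s # xs) \<and> f (s # xs) = j))" for s
    by (rule Suc.IH) (use Suc.prems in simp)
  then show ?case
    by (simp add: sum_distrib_left) (rule sum.swap)
qed

lemma mass_eq_sum_lists:
  assumes "finite A"
  shows "mass A w n P = (\<Sum>xs\<in>{xs. set xs \<subseteq> A \<and> length xs = n \<and> P xs}. prod_list (map w xs))"
proof (induction n arbitrary: P)
  case 0
  show ?case by (cases "P []") (auto simp: conj_commute cong: conj_cong)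
next
  case (Suc n)
  let ?L = "\<lambda>s. {xs. set xs \<subseteq> A \<and> length xs = n \<and> P (s # xs)}"
  have fin: "finite (?L s)" for s
    by (rule finite_subset[OF _ finite_lists_length_eq[OF assms, of n]]) auto
  have "{xs. set xs \<subseteq> A \<and> length xs = Suc n \<and> P xs} = (\<lambda>(s, xs). s # xs) ` (SIGMA s:A. ?L s)"
    by (auto simp: length_Suc_conv image_iff)
  then have "(\<Sum>xs\<in>{xs. set xs \<subseteq> A \<and> length xs = Suc n \<and> P xs}. prod_list (map w xs))
     = (\<Sum>(s, xs)\<in>(SIGMA s:A. ?L s). w s * prod_list (map w xs))"
    by (simp add: sum.reindex inj_on_def case_prod_unfold)
  also have "\<dots> = (\<Sum>s\<in>A. \<Sum>xs\<in>?L s. w s * prod_list (map w xs))"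
    by (subst sum.Sigma) (use assms fin in auto)
  finally show ?case by (simp add: Suc.IH sum_distrib_left)
qed

section \<open>Decomposition at a first occurrence\<close>

definition first :: "('s list \<Rightarrow> bool) \<Rightarrow> 's list \<Rightarrow> bool" where
  "first E xs \<longleftrightarrow> E xs \<and> (\<forall>k < length xs. \<not> E (take k xs))"

lemma first_Cons: "\<not> E [] \<Longrightarrow> first E (s # xs) \<longleftrightarrow> first (\<lambda>xs. E (s # xs)) xs"
  unfolding first_def
  by (auto simp: less_Suc_eq_0_disj)

lemma first_if_Nil: "E [] \<Longrightarrow> first E xs \<longleftrightarrow> xs = []"
  unfolding first_def by force

text \<open>
  The renewal principle: the hypothesis says that an occurrence of \<open>E\<close> erases the past, and that whether
  \<open>E\<close> recurs is decided by \<open>Z\<close> on the later letters alone. With \<open>Z = E\<close> this covers ordinary renewal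
  processes, with \<open>Z \<noteq> E\<close> delayed ones, and with \<open>Z\<close> constantly true the event of having occurred at all.
\<close>

lemma mass_first_decomposition:
  assumes "\<And>ys zs. E ys \<Longrightarrow> E (ys @ zs) = Z zs"
  shows "mass A w n E = (\<Sum>k\<le>n. mass A w k (first E) * mass A w (n - k) Z)"
  using assms
proof (induction n arbitrary: E)
  case 0
  then show ?case using "0"[of "[]" "[]"] by (auto simp: first_def)
next
  case (Suc n)
  show ?case
  proof (cases "E []")
    case True
    have "E = Z" using Suc.prems[OF True] by auto
    moreover have "mass A w (Suc k) (first E) = 0" for k
      by (simp add: first_if_Nil[of E, OF True] mass_False)
    moreover have "first E []" using True by (simp add: first_def)
    ultimately show ?thesis
      by (simp add: sum.atMost_Suc_shift del: sum.atMost_Suc mass.simps(2))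
  next
    case False
    have "\<not> first E []" using False by (simp add: first_def)
    have "mass A w (Suc n) E
        = (\<Sum>s\<in>A. w s * (\<Sum>k\<le>n. mass A w k (\<lambda>xs. first E (s # xs)) * mass A w (n - k) Z))"
      using Suc.prems[of "_ # _"] by (simp add: Suc.IH first_Cons[of E, OF False])
    also have "\<dots> = (\<Sum>k\<le>n. mass A w (Suc k) (first E) * mass A w (n - k) Z)"
      by (simp add: sum_distrib_left sum_distrib_right mult.assoc) (rule sum.swap)
    finally show ?thesis
      using \<open>\<not> first E []\<close> by (simp add: sum.atMost_Suc_shift del: sum.atMost_Suc mass.simps(2))
  qed
qed

section \<open>Agreement of two binomial variables\<close>

text \<open>
  For \<open>\<alpha> + \<beta> = 1\<close> the binomial distribution. The binomial coefficient makes it vanish for \<open>j > l\<close>, which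
  absorbs the truncated subtraction \<open>l - j\<close>.
\<close>

definition binom_prob :: "real \<Rightarrow> real \<Rightarrow> nat \<Rightarrow> nat \<Rightarrow> real" where
  "binom_prob \<alpha> \<beta> l j = real (l choose j) * \<alpha> ^ j * \<beta> ^ (l - j)"

lemma binom_prob_Suc_0: "binom_prob \<alpha> \<beta> (Suc l) 0 = \<beta> * binom_prob \<alpha> \<beta> l 0"
  by (simp add: binom_prob_def)

lemma binom_prob_0: "binom_prob \<alpha> \<beta> 0 j = of_bool (j = 0)"
  by (cases j) (auto simp: binom_prob_def)

lemma binom_prob_Suc_Suc: "binom_prob \<alpha> \<beta> (Suc l) (Suc j) = \<alpha> * binom_prob \<alpha> \<beta> l j + \<beta> * binom_prob \<alpha> \<beta> l (Suc j)"
proof (cases "Suc j \<le> l")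
  case True
  then obtain e where "l = Suc j + e" using le_Suc_ex by blast
  then show ?thesis by (simp add: binom_prob_def algebra_simps)
next
  case False
  then show ?thesis by (simp add: binom_prob_def binomial_eq_0)
qed

definition collision_prob :: "real \<Rightarrow> real \<Rightarrow> nat \<Rightarrow> real" where
  "collision_prob \<alpha> \<beta> m = (\<Sum>j\<le>m. (binom_prob \<alpha> \<beta> m j)\<^sup>2)"

text \<open>
  The relation between three neighbours in a row of Pascal's triangle behind the recurrence for
  \<open>\<Sum>\<^sub>k (m choose k)\<^sup>2 t\<^sup>k\<close>. It follows by expressing \<open>a\<close> and \<open>c\<close> as rational multiples of \<open>b\<close>.
\<close>

lemma choose_quadratic:
  fixes n k :: nat
  defines "a \<equiv> real (n choose k)" and "b \<equiv> real (n choose Suc k)" and "c \<equiv> real (n choose Suc (Suc k))"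
  shows "real n * b\<^sup>2 = a * b + b * c + (real n + 2) * (a * c)"
proof (cases "Suc k \<le> n")
  case False
  then show ?thesis by (simp add: b_def c_def binomial_eq_0)
next
  case True
  then obtain e where n: "n = Suc k + e" using le_Suc_ex by blast
  have 1: "(real k + 1) * b = (real e + 1) * a"
  proof -
    have "Suc k * (n choose Suc k) = (n - k) * (n choose k)"
      using Suc_times_binomial_add binomial_absorb_comp binomial_absorption by (metis)
    then have "real (Suc k * (n choose Suc k)) = real ((n - k) * (n choose k))" by simp
    then show ?thesis using n by (simp add: a_def b_def algebra_simps)
  qed
  have 2: "(real k + 2) * c = real e * b"
  proof -
    have "Suc (Suc k) * (n choose Suc (Suc k)) = (n - Suc k) * (n choose Suc k)"
      using Suc_times_binomial_add binomial_absorb_comp binomial_absorption by (metis)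
    then have "real (Suc (Suc k) * (n choose Suc (Suc k))) = real ((n - Suc k) * (n choose Suc k))" by simp
    then show ?thesis using n by (simp add: c_def b_def algebra_simps)
  qed
  have a: "a = (real k + 1) * b / (real e + 1)" using 1 by (simp add: field_simps)
  have c: "c = real e * b / (real k + 2)" using 2 by (simp add: field_simps)
  have n': "real n = real k + 1 + real e" using n by simp
  have "real e + 1 \<noteq> 0" "real k + 2 \<noteq> 0" by linarith+
  then show ?thesis
    unfolding a c n' by (simp add: divide_simps power2_eq_square) (simp add: algebra_simps)
qed

lemma choose_square_recurrence:
  fixes n k :: nat
  shows "(real n + 2) * (real (Suc (Suc n) choose Suc (Suc k)))\<^sup>2
   = (2 * real n + 3) * ((real (Suc n choose Suc (Suc k)))\<^sup>2 + (real (Suc n choose Suc k))\<^sup>2)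
     - (real n + 1) * ((real (n choose Suc (Suc k)))\<^sup>2 - 2 * (real (n choose Suc k))\<^sup>2 + (real (n choose k))\<^sup>2)"
  using choose_quadratic[of n k]
  by (simp add: power2_eq_square) (simp add: algebra_simps)

text \<open>
  Up to a change of variable these are the Legendre polynomials, and the recurrence below is
  Bonnet's. Stating it for polynomials leaves the summation ranges to coefficient comparison.
\<close>

definition choose_sq_poly :: "nat \<Rightarrow> real poly" where
  "choose_sq_poly m = (\<Sum>k\<le>m. monom ((real (m choose k))\<^sup>2) k)"

lemma coeff_choose_sq_poly: "coeff (choose_sq_poly m) k = (real (m choose k))\<^sup>2"
  by (simp add: choose_sq_poly_def coeff_sum)

lemma choose_sq_poly_recurrence:
  "smult (real n + 2) (choose_sq_poly (Suc (Suc n)))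
   = smult (2 * real n + 3) (choose_sq_poly (Suc n) + pCons 0 (choose_sq_poly (Suc n)))
     - smult (real n + 1) (choose_sq_poly n - smult 2 (pCons 0 (choose_sq_poly n)) + pCons 0 (pCons 0 (choose_sq_poly n)))"
proof (rule poly_eqI)
  fix k
  consider "k = 0" | "k = 1" | j where "k = Suc (Suc j)"
    by (metis One_nat_def not0_implies_Suc)
  then show "coeff (smult (real n + 2) (choose_sq_poly (Suc (Suc n)))) k
    = coeff (smult (2 * real n + 3) (choose_sq_poly (Suc n) + pCons 0 (choose_sq_poly (Suc n)))
     - smult (real n + 1) (choose_sq_poly n - smult 2 (pCons 0 (choose_sq_poly n)) + pCons 0 (pCons 0 (choose_sq_poly n)))) k"
  proof cases
    case 1
    then show ?thesis by (simp add: coeff_choose_sq_poly)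
  next
    case 2
    then show ?thesis by (simp add: coeff_choose_sq_poly power2_eq_square) (simp add: algebra_simps)
  next
    case 3
    then show ?thesis 
      using choose_square_recurrence[of n j] by (simp add: coeff_choose_sq_poly coeff_pCons del: binomial_Suc_Suc)
  qed
qed

lemma collision_prob_eq_poly:
  assumes "\<beta> \<noteq> 0"
  shows "collision_prob \<alpha> \<beta> m = \<beta> ^ (2 * m) * poly (choose_sq_poly m) ((\<alpha> / \<beta>)\<^sup>2)"
  unfolding collision_prob_def choose_sq_poly_def poly_sum sum_distrib_left
proof (rule sum.cong)
  fix j assume "j \<in> {..m}"
  then obtain e where "m = j + e" using le_Suc_ex by auto
  then show "(binom_prob \<alpha> \<beta> m j)\<^sup>2 = \<beta> ^ (2 * m) * poly (monom ((real (m choose j))\<^sup>2) j) ((\<alpha> / \<beta>)\<^sup>2)"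
    using assms by (simp add: binom_prob_def poly_monom power_mult_distrib power_divide power_add
        power_mult[symmetric] mult.commute[of 2])
qed simp

text \<open>
  The polynomial recurrence at \<open>t = (\<alpha> / \<beta>)\<^sup>2\<close>, scaled by powers of \<open>\<beta>\<close>; the assumption \<open>\<alpha> + \<beta> = 1\<close> turns
  \<open>\<alpha>\<^sup>2 + \<beta>\<^sup>2\<close> into \<open>(1 + p) / 2\<close> and \<open>(\<alpha>\<^sup>2 - \<beta>\<^sup>2)\<^sup>2\<close> into \<open>p\<close>. The degenerate case \<open>\<beta> = 0\<close>, where the quotient is
  meaningless, has only collisions.
\<close>

lemma collision_prob_recurrence:
  assumes "\<alpha> + \<beta> = 1"
  defines "p \<equiv> (\<alpha> - \<beta>)\<^sup>2"
  shows "(real n + 2) * collision_prob \<alpha> \<beta> (Suc (Suc n))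
     = (2 * real n + 3) * ((1 + p) / 2) * collision_prob \<alpha> \<beta> (Suc n) - (real n + 1) * p * collision_prob \<alpha> \<beta> n"
proof (cases "\<beta> = 0")
  case True
  have "collision_prob \<alpha> \<beta> m = 1" for m
  proof -
    have "(binom_prob \<alpha> \<beta> m j)\<^sup>2 = of_bool (j = m)" if "j \<le> m" for j
      using assms(1) True that by (auto simp: binom_prob_def)
    then show ?thesis unfolding collision_prob_def by simp
  qed
  then show ?thesis using assms(1) True by (simp add: p_def algebra_simps)
next
  case False
  define t where "t = (\<alpha> / \<beta>)\<^sup>2"
  have "poly (smult (real n + 2) (choose_sq_poly (Suc (Suc n)))) t = poly (smult (2 * real n + 3) (choose_sq_poly (Suc n) + pCons 0 (choose_sq_poly (Suc n)))
     - smult (real n + 1) (choose_sq_poly n - smult 2 (pCons 0 (choose_sq_poly n)) + pCons 0 (pCons 0 (choose_sq_poly n)))) t"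
    by (simp only: choose_sq_poly_recurrence)
  then have rec: "(real n + 2) * poly (choose_sq_poly (Suc (Suc n))) t
     = (2 * real n + 3) * ((1 + t) * poly (choose_sq_poly (Suc n)) t) - (real n + 1) * ((1 - t)\<^sup>2 * poly (choose_sq_poly n) t)"
    by (simp add: power2_eq_square) (simp add: algebra_simps)
  have t1: "\<beta>\<^sup>2 * (1 + t) = (1 + p) / 2"
  proof -
    have "\<beta>\<^sup>2 * (1 + t) = \<beta>\<^sup>2 + \<alpha>\<^sup>2" using False by (simp add: t_def field_simps power2_eq_square)
    moreover have "\<alpha> = 1 - \<beta>" using assms(1) by simp
    ultimately show ?thesis by (simp add: p_def power2_eq_square) (simp add: algebra_simps)
  qed
  have t2: "\<beta> ^ 4 * (1 - t)\<^sup>2 = p"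
  proof -
    have "\<beta> ^ 4 * (1 - t)\<^sup>2 = (\<beta>\<^sup>2 * (1 - t))\<^sup>2" by (simp add: power_mult_distrib)
    also have "\<beta>\<^sup>2 * (1 - t) = \<beta>\<^sup>2 - \<alpha>\<^sup>2" using False by (simp add: t_def field_simps power2_eq_square)
    also have "\<dots> = (\<beta> - \<alpha>) * (\<alpha> + \<beta>)" by (simp add: power2_eq_square algebra_simps)
    also have "\<dots> = \<beta> - \<alpha>" using assms(1) by simp
    also have "(\<beta> - \<alpha>)\<^sup>2 = p" by (simp add: p_def power2_commute)
    finally show ?thesis .
  qed
  have pw: "\<beta> ^ (2 * Suc (Suc n)) = \<beta> ^ (2 * n) * \<beta> ^ 4"
    by (simp add: power4_eq_xxxx mult_ac)
  have "(real n + 2) * collision_prob \<alpha> \<beta> (Suc (Suc n)) = \<beta> ^ (2 * n) * \<beta> ^ 4 * ((real n + 2) * poly (choose_sq_poly (Suc (Suc n))) t)"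
    unfolding collision_prob_eq_poly[OF False] pw t_def by (simp only: mult_ac)
  also have "\<dots> = (2 * real n + 3) * (\<beta>\<^sup>2 * (1 + t)) * (\<beta> ^ (2 * Suc n) * poly (choose_sq_poly (Suc n)) t)
      - (real n + 1) * (\<beta> ^ 4 * (1 - t)\<^sup>2) * (\<beta> ^ (2 * n) * poly (choose_sq_poly n) t)"
    unfolding rec by (simp add: algebra_simps power2_eq_square power4_eq_xxxx)
  finally show ?thesis
    unfolding t1 t2 by (simp add: collision_prob_eq_poly[OF False] t_def)
qed

lemma collision_prob_0: "collision_prob \<alpha> \<beta> 0 = 1" by (simp add: collision_prob_def binom_prob_def)

lemma collision_prob_1: "\<alpha> + \<beta> = 1 \<Longrightarrow> collision_prob \<alpha> \<beta> (Suc 0) = (1 + (\<alpha> - \<beta>)\<^sup>2) / 2"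
proof -
  assume "\<alpha> + \<beta> = 1"
  then have "\<alpha> = 1 - \<beta>" by simp
  then show ?thesis by (simp add: collision_prob_def binom_prob_def power2_eq_square) (simp add: algebra_simps)
qed

text \<open>
  The logarithmic derivative of \<open>((1 - z)(1 - p z))\<^bsup>-1/2\<^esup>\<close>, namely \<open>(1 / (1 - z) + p / (1 - p z)) / 2\<close>. Its
  coefficients are monotone in \<open>p \<ge> 0\<close>, which is the source of all nonnegativity in the proof.
\<close>

definition log_deriv_fps :: "real \<Rightarrow> real fps" where
  "log_deriv_fps p = Abs_fps (\<lambda>n. (1 + p ^ Suc n) / 2)"

lemma log_deriv_fps_clear:
  "(1 - fps_X) * (1 - fps_const p * fps_X) * log_deriv_fps p = fps_const ((1 + p) / 2) - fps_const p * fps_X"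
proof (rule fps_ext)
  fix n
  have eq: "(1 - fps_X) * (1 - fps_const p * fps_X) * log_deriv_fps p
     = log_deriv_fps p - fps_const (1 + p) * (fps_X * log_deriv_fps p) + fps_const p * (fps_X * (fps_X * log_deriv_fps p))"
    by (simp add: algebra_simps fps_const_add[symmetric] del: fps_const_add)
  consider "n = 0" | "n = 1" | j where "n = Suc (Suc j)"
    by (metis One_nat_def not0_implies_Suc)
  then show "((1 - fps_X) * (1 - fps_const p * fps_X) * log_deriv_fps p) $ n = (fps_const ((1 + p) / 2) - fps_const p * fps_X) $ n"
    unfolding eq by cases (simp_all add: log_deriv_fps_def field_simps power2_eq_square)
qed

text \<open>
  Identifies the generating function of \<open>collision_prob\<close> as \<open>((1 - z)(1 - p z))\<^bsup>-1/2\<^esup>\<close> through its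
  logarithmic derivative, so that no square root of a series has to be handled.
\<close>

lemma collision_prob_ode:
  assumes "\<alpha> + \<beta> = 1"
  defines "p \<equiv> (\<alpha> - \<beta>)\<^sup>2"
  shows "fps_deriv (Abs_fps (collision_prob \<alpha> \<beta>)) = log_deriv_fps p * Abs_fps (collision_prob \<alpha> \<beta>)"
proof -
  let ?C = "Abs_fps (collision_prob \<alpha> \<beta>)"
  let ?q = "(1 - fps_X) * (1 - fps_const p * fps_X)"
  have eq: "?q * fps_deriv ?C = fps_deriv ?C - fps_const (1 + p) * (fps_X * fps_deriv ?C) + fps_const p * (fps_X * (fps_X * fps_deriv ?C))"
    by (simp add: algebra_simps fps_const_add[symmetric] del: fps_const_add)
  have "?q * fps_deriv ?C = (fps_const ((1 + p) / 2) - fps_const p * fps_X) * ?C"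
  proof (rule fps_ext)
    fix n
    have eq2: "(fps_const ((1 + p) / 2) - fps_const p * fps_X) * ?C = fps_const ((1 + p) / 2) * ?C - fps_const p * (fps_X * ?C)"
      by (simp add: algebra_simps)
    show "(?q * fps_deriv ?C) $ n = ((fps_const ((1 + p) / 2) - fps_const p * fps_X) * ?C) $ n"
    proof (cases n)
      case 0
      show ?thesis unfolding eq eq2 by (simp add: 0 collision_prob_0 collision_prob_1[OF assms(1), folded p_def])
    next
      case (Suc m)
      show ?thesis
        using collision_prob_recurrence[OF assms(1), of m, folded p_def] unfolding eq eq2 Suc
        by (cases m) (simp_all add: field_simps)
    qed
  qed
  also have "\<dots> = ?q * (log_deriv_fps p * ?C)" using log_deriv_fps_clear[of p] by (simp add: mult.assoc[symmetric])
  finally have "?q * fps_deriv ?C = ?q * (log_deriv_fps p * ?C)" .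
  moreover have "?q $ 0 = 1" by simp
  then have "?q \<noteq> 0" by (metis fps_zero_nth zero_neq_one)
  ultimately show ?thesis by simp
qed

text \<open>
  The quotient \<open>K\<close> of the two generating functions satisfies \<open>K' = L K\<close>, where \<open>L\<close> is the difference of the
  logarithmic derivatives. As \<open>(\<alpha> - \<beta>)\<^sup>2 = 1 - 4 \<alpha> \<beta>\<close>, the hypothesis on the products makes the
  coefficients of \<open>L\<close> nonnegative, and the differential equation passes this on to \<open>K\<close>.
\<close>

lemma collision_prob_convolution:
  assumes ab: "\<alpha> + \<beta> = 1" and ab': "\<alpha>' + \<beta>' = 1" and le: "\<alpha> * \<beta> \<le> \<alpha>' * \<beta>'"
  shows "\<exists>\<kappa>. (\<forall>i. 0 \<le> \<kappa> i) \<and> (\<forall>m. collision_prob \<alpha> \<beta> m = (\<Sum>i\<le>m. \<kappa> i * collision_prob \<alpha>' \<beta>' (m - i)))"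
proof -
  define C where "C = Abs_fps (collision_prob \<alpha> \<beta>)"
  define C' where "C' = Abs_fps (collision_prob \<alpha>' \<beta>')"
  define p where "p = (\<alpha> - \<beta>)\<^sup>2"
  define p' where "p' = (\<alpha>' - \<beta>')\<^sup>2"
  define K where "K = C * inverse C'"
  have C0: "C' $ 0 = 1" "C $ 0 = 1" by (simp_all add: C_def C'_def collision_prob_0)
  have nz: "C' \<noteq> 0" using C0 by (metis fps_zero_nth zero_neq_one)
  have CK: "C = K * C'" unfolding K_def using C0 by (simp add: mult.assoc inverse_mult_eq_1)
  have "log_deriv_fps p * C = fps_deriv K * C' + K * (log_deriv_fps p' * C')"
    using collision_prob_ode[OF ab] collision_prob_ode[OF ab'] CK
    by (metis C'_def C_def fps_deriv_mult p'_def p_def add.commute)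
  then have "(fps_deriv K) * C' = ((log_deriv_fps p - log_deriv_fps p') * K) * C'"
    unfolding CK by (simp add: algebra_simps)
  then have dK: "fps_deriv K = (log_deriv_fps p - log_deriv_fps p') * K" using nz by simp
  have pp: "p' \<le> p"
  proof -
    have "\<alpha> = 1 - \<beta>" "\<alpha>' = 1 - \<beta>'" using ab ab' by auto
    then show ?thesis using le by (simp add: p_def p'_def power2_eq_square) (simp add: algebra_simps)
  qed
  have L: "0 \<le> (log_deriv_fps p - log_deriv_fps p') $ n" for n
    using power_mono[OF pp, of "Suc n"] by (simp add: log_deriv_fps_def p'_def del: power_Suc)
  have K0: "K $ 0 = 1" using CK C0 by simp
  have pos: "0 \<le> K $ n" for n
  proof (induction n rule: less_induct)
    case (less n)
    show ?case
    proof (cases n)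
      case 0
      then show ?thesis using K0 by simp
    next
      case (Suc m)
      have "real (Suc m) * K $ Suc m = (\<Sum>i=0..m. (log_deriv_fps p - log_deriv_fps p') $ i * K $ (m - i))"
        using arg_cong[OF dK, of "\<lambda>f. f $ m"] by (simp add: fps_mult_nth)
      also have "\<dots> \<ge> 0"
        by (intro sum_nonneg mult_nonneg_nonneg L less.IH) (use Suc in auto)
      finally show ?thesis using Suc by (simp add: zero_le_mult_iff)
    qed
  qed
  have "collision_prob \<alpha> \<beta> m = (\<Sum>i\<le>m. K $ i * collision_prob \<alpha>' \<beta>' (m - i))" for m
    using arg_cong[OF CK, of "\<lambda>f. f $ m"] by (simp add: C_def C'_def fps_mult_nth atMost_atLeast0)
  then show ?thesis using pos by blast
qed

section \<open>Splitting a class of steps by coin tosses\<close>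

text \<open>
  Conditioning on the positions of the letters \<open>x\<close> and \<open>y\<close> in a list, and on all its other letters, which of
  \<open>x\<close> and \<open>y\<close> occurs at these positions is decided by independent coins. Ignoring the first \<open>i\<close> of the \<open>l\<close>
  positions leaves a binomial count from \<open>l - i\<close> coins. The weight \<open>w'\<close> on the right may share the common
  weight of \<open>x\<close> and \<open>y\<close> between them in any other way, because the predicate there does not
  distinguish the two letters.
\<close>

lemma mass_split_class:
  fixes x y :: 's
  assumes fin: "finite A" and xy: "x \<in> A" "y \<in> A" "x \<noteq> y"
    and wx: "w x = (w' x + w' y) * \<alpha>" and wy: "w y = (w' x + w' y) * \<beta>" and sum1: "\<alpha> + \<beta> = 1"
    and off: "\<And>s. s \<noteq> x \<Longrightarrow> s \<noteq> y \<Longrightarrow> w s = w' s"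
  shows "mass A w n (\<lambda>xs. length (filter (\<lambda>s. s = x \<or> s = y) xs) = l
             \<and> count_list (drop i (filter (\<lambda>s. s = x \<or> s = y) xs)) x = j
             \<and> R (filter (\<lambda>s. \<not> (s = x \<or> s = y)) xs))
       = binom_prob \<alpha> \<beta> (l - i) j * mass A w' n (\<lambda>xs. length (filter (\<lambda>s. s = x \<or> s = y) xs) = l
             \<and> R (filter (\<lambda>s. \<not> (s = x \<or> s = y)) xs))"
    (is "mass A w n (?P l i j R) = _ * mass A w' n (?Q l R)")
proof (induction n arbitrary: l i j R)
  case 0
  then show ?case by (auto simp: binom_prob_0)
next
  case (Suc n)
  let ?B = "A - {x, y}"
  have dec: "(\<Sum>s\<in>A. f s) = f x + f y + (\<Sum>s\<in>?B. f s)" for f :: "'s \<Rightarrow> real"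
  proof -
    have "(\<Sum>s\<in>A. f s) = f x + (\<Sum>s\<in>A - {x}. f s)" by (rule sum.remove) (use fin xy in auto)
    also have "(\<Sum>s\<in>A - {x}. f s) = f y + (\<Sum>s\<in>A - {x} - {y}. f s)"
      by (rule sum.remove) (use fin xy in auto)
    also have "A - {x} - {y} = ?B" by auto
    finally show ?thesis by simp
  qed
  have rest: "(\<Sum>s\<in>?B. w s * mass A w n (\<lambda>xs. ?P l i j R (s # xs)))
      = binom_prob \<alpha> \<beta> (l - i) j * (\<Sum>s\<in>?B. w' s * mass A w' n (\<lambda>xs. ?Q l R (s # xs)))"
    unfolding sum_distrib_left
  proof (rule sum.cong)
    fix s assume "s \<in> ?B"
    then have s: "s \<noteq> x" "s \<noteq> y" by auto
    have "mass A w n (\<lambda>xs. ?P l i j R (s # xs)) = mass A w n (?P l i j (\<lambda>zs. R (s # zs)))"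
      using s by simp
    also have "\<dots> = binom_prob \<alpha> \<beta> (l - i) j * mass A w' n (?Q l (\<lambda>zs. R (s # zs)))"
      by (rule Suc.IH)
    also have "mass A w' n (?Q l (\<lambda>zs. R (s # zs))) = mass A w' n (\<lambda>xs. ?Q l R (s # xs))"
      using s by simp
    finally show "w s * mass A w n (\<lambda>xs. ?P l i j R (s # xs))
        = binom_prob \<alpha> \<beta> (l - i) j * (w' s * mass A w' n (\<lambda>xs. ?Q l R (s # xs)))"
      using off[OF s] by simp
  qed simp
  have special: "w x * mass A w n (\<lambda>xs. ?P l i j R (x # xs)) + w y * mass A w n (\<lambda>xs. ?P l i j R (y # xs))
      = binom_prob \<alpha> \<beta> (l - i) j * (w' x * mass A w' n (\<lambda>xs. ?Q l R (x # xs)) + w' y * mass A w' n (\<lambda>xs. ?Q l R (y # xs)))"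
  proof (cases l)
    case 0
    then show ?thesis by (simp add: mass_False)
  next
    case l: (Suc l')
    have Q: "mass A w' n (\<lambda>xs. ?Q l R (x # xs)) = mass A w' n (?Q l' R)"
            "mass A w' n (\<lambda>xs. ?Q l R (y # xs)) = mass A w' n (?Q l' R)"
      by (simp_all add: l)
    show ?thesis
    proof (cases i)
      case i: (Suc i')
      have P: "mass A w n (\<lambda>xs. ?P l i j R (x # xs)) = mass A w n (?P l' i' j R)"
              "mass A w n (\<lambda>xs. ?P l i j R (y # xs)) = mass A w n (?P l' i' j R)"
        by (simp_all add: l i)
      have "w x + w y = w' x + w' y" using sum1 by (simp add: wx wy flip: distrib_left)
      then show ?thesis
        unfolding P Q Suc.IH by (simp add: l i flip: distrib_right)
    next
      case i: 0
      have Py: "mass A w n (\<lambda>xs. ?P l i j R (y # xs)) = binom_prob \<alpha> \<beta> l' j * mass A w' n (?Q l' R)"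
        using xy Suc.IH[of l' 0 j R] by (simp add: l i)
      show ?thesis
      proof (cases j)
        case j: 0
        have Px: "mass A w n (\<lambda>xs. ?P l i j R (x # xs)) = 0"
          by (simp add: l i j mass_False)
        show ?thesis unfolding Px Py Q
          by (simp add: l i j binom_prob_Suc_0 wy algebra_simps)
      next
        case j: (Suc j')
        have Px: "mass A w n (\<lambda>xs. ?P l i j R (x # xs)) = binom_prob \<alpha> \<beta> l' j' * mass A w' n (?Q l' R)"
          using Suc.IH[of l' 0 j' R] by (simp add: l i j)
        show ?thesis unfolding Px Py Q
          by (simp add: l i j binom_prob_Suc_Suc wy wx algebra_simps)
      qed
    qed
  qed
  show ?case
    unfolding mass.simps dec rest special by (simp add: algebra_simps)
qed

section \<open>Closed and delayed-closed lists of lattice steps\<close>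

definition dirs :: "nat \<Rightarrow> (nat \<times> bool) set" where
  "dirs d = {1..d} \<times> UNIV"

lemma finite_dirs: "finite (dirs d)"
  by (simp add: dirs_def)

lemma mem_dirs: "s \<in> dirs d \<longleftrightarrow> fst s \<in> {1..d}"
  by (cases s) (simp add: dirs_def)

definition step_weight :: "(nat \<Rightarrow> real) \<Rightarrow> nat \<times> bool \<Rightarrow> real" where
  "step_weight h s = h (fst s) / 2"

definition balanced :: "(nat \<times> bool) list \<Rightarrow> bool" where
  "balanced xs \<longleftrightarrow> (\<forall>c. count_list xs (c, True) = count_list xs (c, False))"

abbreviation walk_mass :: "nat \<Rightarrow> (nat \<Rightarrow> real) \<Rightarrow> nat \<Rightarrow> ((nat \<times> bool) list \<Rightarrow> bool) \<Rightarrow> real" where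
  "walk_mass d h \<equiv> mass (dirs d) (step_weight h)"

lemma balanced_append: "balanced ys \<Longrightarrow> balanced (ys @ zs) = balanced zs"
  by (simp add: balanced_def)

definition along :: "nat \<Rightarrow> nat \<Rightarrow> bool \<Rightarrow> (nat \<times> bool) list \<Rightarrow> (nat \<times> bool) list" where
  "along a b sg = filter (\<lambda>s. s = (a, sg) \<or> s = (b, sg))"

text \<open>
  The path is closed once the choice between the coordinates \<open>a\<close> and \<open>b\<close> is ignored for its first \<open>i\<close>
  positive and its first \<open>i\<close> negative steps along these coordinates. Given equally many positive
  and negative steps, it suffices to balance the steps along \<open>a\<close>. Discarding the first steps, rather than
  the last ones, makes the condition renewable: see \<open>delayed_append\<close>.
\<close>

definition delayed :: "nat \<Rightarrow> nat \<Rightarrow> nat \<Rightarrow> (nat \<times> bool) list \<Rightarrow> bool" where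
  "delayed a b i xs \<longleftrightarrow>
     i \<le> length (along a b True xs) \<and> length (along a b True xs) = length (along a b False xs) \<and>
     count_list (drop i (along a b True xs)) (a, True) = count_list (drop i (along a b False xs)) (a, False) \<and>
     (\<forall>c. c \<noteq> a \<longrightarrow> c \<noteq> b \<longrightarrow> count_list xs (c, True) = count_list xs (c, False))"

lemma length_along: "a \<noteq> b \<Longrightarrow> length (along a b sg xs) = count_list xs (a, sg) + count_list xs (b, sg)"
  unfolding along_def by (induction xs) auto

lemma count_along: "count_list (along a b sg xs) (a, sg) = count_list xs (a, sg)"
  unfolding along_def by (induction xs) auto

lemma balanced_iff_along:
  assumes "a \<noteq> b"
  shows "balanced zs \<longleftrightarrow> length (along a b True zs) = length (along a b False zs) \<and>
     count_list (along a b True zs) (a, True) = count_list (along a b False zs) (a, False) \<and>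
     (\<forall>c. c \<noteq> a \<longrightarrow> c \<noteq> b \<longrightarrow> count_list zs (c, True) = count_list zs (c, False))"
  unfolding balanced_def length_along[OF assms] count_along
  by (metis add_left_cancel)

lemma delayed_0: "a \<noteq> b \<Longrightarrow> delayed a b 0 = balanced"
  by (rule ext) (simp add: delayed_def balanced_iff_along)

lemma delayed_append:
  assumes "a \<noteq> b" "delayed a b i ys"
  shows "delayed a b i (ys @ zs) = balanced zs"
  using assms(2) unfolding balanced_iff_along[OF assms(1)] delayed_def
  by (auto simp: along_def)

definition return_gf :: "nat \<Rightarrow> (nat \<Rightarrow> real) \<Rightarrow> real fps" where
  "return_gf d h = Abs_fps (\<lambda>n. walk_mass d h n balanced)"


definition balanced_off :: "nat \<Rightarrow> nat \<Rightarrow> nat \<Rightarrow> (nat \<times> bool) list \<Rightarrow> bool" where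
  "balanced_off a b m xs \<longleftrightarrow> length (along a b True xs) = m \<and> length (along a b False xs) = m \<and>
     (\<forall>c. c \<noteq> a \<longrightarrow> c \<noteq> b \<longrightarrow> count_list xs (c, True) = count_list xs (c, False))"

lemma count_list_filter: "count_list (filter P xs) x = (if P x then count_list xs x else 0)"
  by (induction xs) auto

lemma along_filter_other:
  "sg \<noteq> sg' \<Longrightarrow> along a b sg (filter (\<lambda>s. \<not> (s = (a, sg') \<or> s = (b, sg'))) xs) = along a b sg xs"
  unfolding along_def filter_filter by (rule filter_cong) auto

text \<open>
  The coins of the positive and of the negative steps are split off one after the other; each contributes a
  factor \<open>binom_prob\<close>, and what remains does not see how the weight \<open>\<sigma>\<close> is shared between \<open>a\<close> and \<open>b\<close>.
  The vector with the entries \<open>\<sigma>\<close> and \<open>0\<close> serves as a normal form, common to the two vectors compared in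
  \<open>dominates_transfer\<close>.
\<close>

lemma walk_mass_delayed_counts:
  assumes ab: "a \<in> {1..d}" "b \<in> {1..d}" "a \<noteq> b"
    and ha: "h a = \<sigma> * \<alpha>" and hb: "h b = \<sigma> * \<beta>" and one: "\<alpha> + \<beta> = 1" and im: "i \<le> m"
  shows "walk_mass d h n (\<lambda>xs. delayed a b i xs \<and>
       (length (along a b True xs), count_list (drop i (along a b True xs)) (a, True)) = (m, j))
     = (binom_prob \<alpha> \<beta> (m - i) j)\<^sup>2 * walk_mass d (h(a := \<sigma>, b := 0)) n (balanced_off a b m)"
proof -
  let ?h0 = "h(a := \<sigma>, b := 0)"
  \<comment> \<open>Positive steps already carry the merged weights, negative ones still the original weights.\<close>
  define w' where "w' s = (if snd s then ?h0 (fst s) / 2 else h (fst s) / 2)" for s :: "nat \<times> bool"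
  define R2 where "R2 zs \<longleftrightarrow> (\<forall>c. c \<noteq> a \<longrightarrow> c \<noteq> b \<longrightarrow> count_list zs (c, True) = count_list zs (c, False))"
    for zs :: "(nat \<times> bool) list"
  define R where "R zs \<longleftrightarrow> length (along a b False zs) = m \<and>
      count_list (drop i (along a b False zs)) (a, False) = j \<and> R2 zs" for zs
  define R' where "R' zs \<longleftrightarrow> length (along a b True zs) = m \<and> R2 zs" for zs
  have R2_filter: "R2 (filter (\<lambda>s. \<not> (s = (a, sg) \<or> s = (b, sg))) xs) = R2 xs" for sg xs
    by (simp add: R2_def count_list_filter)
  have R_filter: "R (filter (\<lambda>s. \<not> (s = (a, True) \<or> s = (b, True))) xs) = R xs" for xs
    unfolding R_def R2_filter by (simp only: along_filter_other simp_thms bool_simps)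
  have R'_filter: "R' (filter (\<lambda>s. \<not> (s = (a, False) \<or> s = (b, False))) xs) = R' xs" for xs
    unfolding R'_def R2_filter by (simp only: along_filter_other simp_thms bool_simps)
  note fin = finite_dirs[of d]
  have "walk_mass d h n (\<lambda>xs. delayed a b i xs \<and>
       (length (along a b True xs), count_list (drop i (along a b True xs)) (a, True)) = (m, j))
     = walk_mass d h n (\<lambda>xs. length (along a b True xs) = m
         \<and> count_list (drop i (along a b True xs)) (a, True) = j
         \<and> R (filter (\<lambda>s. \<not> (s = (a, True) \<or> s = (b, True))) xs))"
    unfolding R_filter using im
    by (intro mass_cong) (auto simp: delayed_def R_def R2_def)
  also have "\<dots> = binom_prob \<alpha> \<beta> (m - i) j * mass (dirs d) w' n (\<lambda>xs. length (along a b True xs) = m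
         \<and> R (filter (\<lambda>s. \<not> (s = (a, True) \<or> s = (b, True))) xs))"
    unfolding along_def
    by (rule mass_split_class[OF fin _ _ _ _ _ one])
      (use ab in \<open>auto simp: step_weight_def w'_def ha hb mem_dirs\<close>)
  also have "(\<lambda>xs. length (along a b True xs) = m
         \<and> R (filter (\<lambda>s. \<not> (s = (a, True) \<or> s = (b, True))) xs))
     = (\<lambda>xs. length (along a b False xs) = m
         \<and> count_list (drop i (along a b False xs)) (a, False) = j
         \<and> R' (filter (\<lambda>s. \<not> (s = (a, False) \<or> s = (b, False))) xs))"
    unfolding R_filter R'_filter by (auto simp: R_def R'_def)
  also have "mass (dirs d) w' n \<dots> = binom_prob \<alpha> \<beta> (m - i) j * walk_mass d ?h0 n (\<lambda>xs. length (along a b False xs) = m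
         \<and> R' (filter (\<lambda>s. \<not> (s = (a, False) \<or> s = (b, False))) xs))"
    unfolding along_def
    by (rule mass_split_class[OF fin _ _ _ _ _ one])
      (use ab in \<open>auto simp: step_weight_def w'_def ha hb mem_dirs\<close>)
  also have "(\<lambda>xs. length (along a b False xs) = m
         \<and> R' (filter (\<lambda>s. \<not> (s = (a, False) \<or> s = (b, False))) xs)) = balanced_off a b m"
    unfolding R'_filter by (auto simp: R'_def R2_def balanced_off_def)
  finally show ?thesis by (simp only: power2_eq_square mult.assoc)
qed

lemma collision_prob_eq_sum_upto:
  assumes "m \<le> n"
  shows "collision_prob \<alpha> \<beta> m = (\<Sum>j\<le>n. (binom_prob \<alpha> \<beta> m j)\<^sup>2)"
  unfolding collision_prob_def
  by (rule sum.mono_neutral_left) (use assms in \<open>auto simp: binom_prob_def binomial_eq_0\<close>)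

lemma length_along_le: "length (along a b sg xs) \<le> length xs"
  by (simp add: along_def)

text \<open>
  Only the factor \<open>collision_prob\<close> depends on the shares \<open>\<alpha>\<close> and \<open>\<beta>\<close>, and ignoring \<open>i\<close> pairs of coins merely
  shifts its argument. This turns the convolution identity for \<open>collision_prob\<close> into one for the walks.
\<close>

lemma walk_mass_delayed:
  assumes ab: "a \<in> {1..d}" "b \<in> {1..d}" "a \<noteq> b"
    and ha: "h a = \<sigma> * \<alpha>" and hb: "h b = \<sigma> * \<beta>" and one: "\<alpha> + \<beta> = 1"
  shows "walk_mass d h n (delayed a b i) = (\<Sum>m=i..n. collision_prob \<alpha> \<beta> (m - i) *
     walk_mass d (h(a := \<sigma>, b := 0)) n (balanced_off a b m))"
proof -
  let ?f = "\<lambda>xs. (length (along a b True xs), count_list (drop i (along a b True xs)) (a, True))"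
  let ?m = "\<lambda>p. walk_mass d h n (\<lambda>xs. delayed a b i xs \<and> ?f xs = p)"
  let ?T = "\<lambda>m. walk_mass d (h(a := \<sigma>, b := 0)) n (balanced_off a b m)"
  have "?f xs \<in> {..n} \<times> {..n}" if "length xs = n" for xs
  proof -
    have "count_list (drop i (along a b True xs)) (a, True) \<le> length (drop i (along a b True xs))"
      by (rule count_le_length)
    then show ?thesis using length_along_le[of a b True xs] that by simp
  qed
  then have "walk_mass d h n (delayed a b i) = (\<Sum>p\<in>{..n} \<times> {..n}. ?m p)"
    by (intro mass_partition) auto
  also have "\<dots> = (\<Sum>m\<le>n. \<Sum>j\<le>n. ?m (m, j))"
    by (simp only: sum.cartesian_product case_prod_unfold prod.collapse)
  also have "\<dots> = (\<Sum>m=i..n. \<Sum>j\<le>n. ?m (m, j))"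
  proof (rule sum.mono_neutral_right)
    have "?m (m, j) = 0" if "m < i" for m j
    proof -
      have "(\<lambda>xs. delayed a b i xs \<and> ?f xs = (m, j)) = (\<lambda>_. False)"
        using that by (auto simp: delayed_def)
      then show ?thesis by (simp only: mass_False)
    qed
    then show "\<forall>m\<in>{..n} - {i..n}. (\<Sum>j\<le>n. ?m (m, j)) = 0" by auto
  qed auto
  also have "\<dots> = (\<Sum>m=i..n. collision_prob \<alpha> \<beta> (m - i) * ?T m)"
  proof (rule sum.cong)
    fix m assume m: "m \<in> {i..n}"
    then have "(\<Sum>j\<le>n. ?m (m, j)) = (\<Sum>j\<le>n. (binom_prob \<alpha> \<beta> (m - i) j)\<^sup>2 * ?T m)"
      by (intro sum.cong refl walk_mass_delayed_counts[OF assms]) simp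
    also have "\<dots> = collision_prob \<alpha> \<beta> (m - i) * ?T m"
      using m by (subst collision_prob_eq_sum_upto[of "m - i" n]) (auto simp: sum_distrib_right)
    finally show "(\<Sum>j\<le>n. ?m (m, j)) = collision_prob \<alpha> \<beta> (m - i) * ?T m" .
  qed simp
  finally show ?thesis .
qed

section \<open>Quotients of return generating functions\<close>

definition dominates :: "nat \<Rightarrow> (nat \<Rightarrow> real) \<Rightarrow> (nat \<Rightarrow> real) \<Rightarrow> bool" where
  "dominates d h h' \<longleftrightarrow> (\<exists>K. return_gf d h = return_gf d h' * K \<and> (\<forall>n. 0 \<le> K $ n))"

lemma dominates_refl: "dominates d h h"
  unfolding dominates_def by (rule exI[of _ 1]) auto

lemma dominates_trans:
  assumes "dominates d h h'" "dominates d h' h''"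
  shows "dominates d h h''"
proof -
  from assms obtain K L where K: "return_gf d h = return_gf d h' * K" "\<And>n. 0 \<le> K $ n"
    and L: "return_gf d h' = return_gf d h'' * L" "\<And>n. 0 \<le> L $ n"
    unfolding dominates_def by blast
  have "return_gf d h = return_gf d h'' * (L * K)" using K L by (simp add: mult.assoc)
  moreover have "0 \<le> (L * K) $ n" for n
    unfolding fps_mult_nth by (intro sum_nonneg mult_nonneg_nonneg K L)
  ultimately show ?thesis unfolding dominates_def by blast
qed

lemma sum_triangle_swap:
  fixes f :: "nat \<Rightarrow> nat \<Rightarrow> real"
  shows "(\<Sum>m\<le>n. \<Sum>i\<le>m. f m i) = (\<Sum>i\<le>n. \<Sum>m=i..n. f m i)"
proof -
  have "(\<Sum>m\<le>n. \<Sum>i\<le>m. f m i) = (\<Sum>(m, i)\<in>(SIGMA m:{..n}. {..m}). f m i)"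
    by (rule sum.Sigma) auto
  also have "\<dots> = (\<Sum>(i, m)\<in>(SIGMA i:{..n}. {i..n}). f m i)"
    by (rule sum.reindex_bij_witness[of _ "\<lambda>(i, m). (m, i)" "\<lambda>(m, i). (i, m)"]) auto
  also have "\<dots> = (\<Sum>i\<le>n. \<Sum>m=i..n. f m i)"
    by (rule sum.Sigma[symmetric]) auto
  finally show ?thesis .
qed

text \<open>
  A return of the walk \<open>h\<close> is expressed through delayed returns of the walk \<open>h'\<close> by means of \<open>\<kappa>\<close>. Each family of
  delayed returns is a delayed renewal process, so its generating function is a multiple of
  \<open>return_gf d h'\<close> with nonnegative coefficients.
\<close>

lemma dominates_transfer:
  assumes nonneg: "\<And>c. c \<in> {1..d} \<Longrightarrow> 0 \<le> h' c"
    and ab: "a \<in> {1..d}" "b \<in> {1..d}" "a \<noteq> b"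
    and same: "\<And>c. c \<noteq> a \<Longrightarrow> c \<noteq> b \<Longrightarrow> h c = h' c"
    and total: "h a + h b = h' a + h' b" "0 < h a + h b"
    and prod: "h a * h b \<le> h' a * h' b"
  shows "dominates d h h'"
proof -
  define \<sigma> where "\<sigma> = h a + h b"
  have \<sigma>: "0 < \<sigma>" "\<sigma> = h' a + h' b" using total by (auto simp: \<sigma>_def)
  define \<alpha> \<beta> \<alpha>' \<beta>' where "\<alpha> = h a / \<sigma>" "\<beta> = h b / \<sigma>" "\<alpha>' = h' a / \<sigma>" "\<beta>' = h' b / \<sigma>"
  note defs = this
  have one: "\<alpha> + \<beta> = 1" "\<alpha>' + \<beta>' = 1"
    using \<sigma> by (auto simp: defs \<sigma>_def simp flip: add_divide_distrib)
  have scaled: "h a = \<sigma> * \<alpha>" "h b = \<sigma> * \<beta>" "h' a = \<sigma> * \<alpha>'" "h' b = \<sigma> * \<beta>'"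
    using \<sigma>(1) by (simp_all add: defs)
  have "\<alpha> * \<beta> \<le> \<alpha>' * \<beta>'"
    using prod \<sigma>(1) by (simp add: defs divide_right_mono)
  from collision_prob_convolution[OF one this] obtain \<kappa> where \<kappa>: "\<And>i. 0 \<le> \<kappa> i"
    and conv: "\<And>m. collision_prob \<alpha> \<beta> m = (\<Sum>i\<le>m. \<kappa> i * collision_prob \<alpha>' \<beta>' (m - i))"
    by metis
  have merged: "h'(a := \<sigma>, b := 0) = h(a := \<sigma>, b := 0)" using same by auto
  let ?T = "\<lambda>n m. walk_mass d (h(a := \<sigma>, b := 0)) n (balanced_off a b m)"
  let ?r = "\<lambda>i k. walk_mass d h' k (first (delayed a b i))"
  let ?u = "\<lambda>n. walk_mass d h' n balanced"
  have r0: "?r i k = 0" if "k < i" for i k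
  proof -
    have "\<not> delayed a b i xs" if "length xs = k" for xs
      using that \<open>k < i\<close> length_along_le[of a b True xs] by (simp add: delayed_def)
    then have "?r i k = walk_mass d h' k (\<lambda>_. False)"
      by (intro mass_cong) (simp add: first_def)
    then show ?thesis by (simp only: mass_False)
  qed
  \<comment> \<open>The sum may be cut off at \<open>k\<close> by \<open>r0\<close>: a delayed return needs at least \<open>i\<close> steps.\<close>
  define K where "K = Abs_fps (\<lambda>k. \<Sum>i\<le>k. \<kappa> i * ?r i k)"
  have "walk_mass d h n balanced = (return_gf d h' * K) $ n" for n
  proof -
    have "walk_mass d h n balanced = (\<Sum>m\<le>n. collision_prob \<alpha> \<beta> m * ?T n m)"
      using walk_mass_delayed[OF ab scaled(1,2) one(1), of n 0]
      by (simp add: delayed_0[OF ab(3)] atMost_atLeast0)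
    also have "\<dots> = (\<Sum>m\<le>n. \<Sum>i\<le>m. \<kappa> i * collision_prob \<alpha>' \<beta>' (m - i) * ?T n m)"
      by (simp add: conv sum_distrib_right)
    also have "\<dots> = (\<Sum>i\<le>n. \<Sum>m=i..n. \<kappa> i * collision_prob \<alpha>' \<beta>' (m - i) * ?T n m)"
      by (rule sum_triangle_swap)
    also have "\<dots> = (\<Sum>i\<le>n. \<kappa> i * walk_mass d h' n (delayed a b i))"
      unfolding walk_mass_delayed[OF ab scaled(3,4) one(2)] merged
      by (simp add: sum_distrib_left mult.assoc)
    also have "\<dots> = (\<Sum>i\<le>n. \<kappa> i * (\<Sum>k\<le>n. ?r i k * ?u (n - k)))"
      by (subst mass_first_decomposition[of "delayed a b _" balanced]) (simp_all add: delayed_append[OF ab(3)])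
    also have "\<dots> = (\<Sum>k\<le>n. (\<Sum>i\<le>n. \<kappa> i * ?r i k) * ?u (n - k))"
      by (simp add: sum_distrib_left sum_distrib_right mult.assoc) (rule sum.swap)
    also have "\<dots> = (\<Sum>k\<le>n. K $ k * ?u (n - k))"
    proof (rule sum.cong)
      fix k assume "k \<in> {..n}"
      then have "(\<Sum>i\<le>n. \<kappa> i * ?r i k) = (\<Sum>i\<le>k. \<kappa> i * ?r i k)"
        by (intro sum.mono_neutral_right) (auto simp: r0)
      then show "(\<Sum>i\<le>n. \<kappa> i * ?r i k) * ?u (n - k) = K $ k * ?u (n - k)"
        by (simp add: K_def)
    qed simp
    also have "\<dots> = (K * return_gf d h') $ n"
      by (simp add: fps_mult_nth return_gf_def atMost_atLeast0)
    finally show ?thesis by (simp add: mult.commute)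
  qed
  then have "return_gf d h = return_gf d h' * K"
    by (intro fps_ext) (simp add: return_gf_def)
  moreover have "0 \<le> K $ n" for n
    unfolding K_def fps_nth_Abs_fps using nonneg
    by (intro sum_nonneg mult_nonneg_nonneg \<kappa> mass_nonneg) (auto simp: step_weight_def mem_dirs)
  ultimately show ?thesis unfolding dominates_def by blast
qed

section \<open>Transfers to the uniform vector\<close>

text \<open>
  A vector that is not uniform has an entry above and an entry below \<open>1 / d\<close>. Replacing the larger one by
  \<open>1 / d\<close>, a value between the two, and adding the difference to the smaller one does not decrease their
  product, and it lowers the number of entries different from \<open>1 / d\<close>.
\<close>

lemma dominates_uniform:
  assumes "1 \<le> d" "prob_vector d h" 
  shows "dominates d h (uniform_vector d)"
  using assms(2)
proof (induction "card {c \<in> {1..d}. h c \<noteq> 1 / real d}" arbitrary: h rule: less_induct)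
  case less
  let ?S = "\<lambda>h. {c \<in> {1..d}. h c \<noteq> 1 / real d}"
  have h0: "\<And>c. c \<in> {1..d} \<Longrightarrow> 0 \<le> h c" and h1: "(\<Sum>c=1..d. h c) = 1"
    using less.prems by (auto simp: prob_vector_def)
  have u1: "(\<Sum>c=1..d. 1 / real d) = 1" using assms(1) by simp
  show ?case
  proof (cases "?S h = {}")
    case True
    have "walk_mass d h n balanced = walk_mass d (uniform_vector d) n balanced" for n
      by (rule mass_weight_cong) (use True in \<open>auto simp: step_weight_def uniform_vector_def mem_dirs\<close>)
    then have "return_gf d h = return_gf d (uniform_vector d)" by (simp add: return_gf_def)
    then show ?thesis using dominates_refl[of d "uniform_vector d"] by (simp add: dominates_def)
  next
    case False
    then obtain e where e: "e \<in> {1..d}" "h e \<noteq> 1 / real d" by auto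
    obtain a where a: "a \<in> {1..d}" "1 / real d < h a"
    proof (rule ccontr)
      assume "\<not> thesis"
      then have le: "\<And>c. c \<in> {1..d} \<Longrightarrow> h c \<le> 1 / real d" using that by force
      then have "(\<Sum>c=1..d. h c) < (\<Sum>c=1..d. 1 / real d)"
        using e by (intro sum_strict_mono_ex1) force+
      then show False using h1 u1 by simp
    qed
    obtain b where b: "b \<in> {1..d}" "h b < 1 / real d"
    proof (rule ccontr)
      assume "\<not> thesis"
      then have le: "\<And>c. c \<in> {1..d} \<Longrightarrow> 1 / real d \<le> h c" using that by force
      then have "(\<Sum>c=1..d. 1 / real d) < (\<Sum>c=1..d. h c)"
        using e by (intro sum_strict_mono_ex1) force+
      then show False using h1 u1 by simp
    qed
    have ab: "a \<noteq> b" using a b by auto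
    define h' where "h' = h(a := 1 / real d, b := h a + h b - 1 / real d)"
    have h'0: "0 \<le> h' c" if "c \<in> {1..d}" for c
      using h0[OF that] h0[OF b(1)] a(2) by (auto simp: h'_def)
    have split2: "(\<Sum>c=1..d. f c) = f a + f b + (\<Sum>c\<in>{1..d} - {a, b}. f c)" for f :: "nat \<Rightarrow> real"
      using sum.subset_diff[of "{a, b}" "{1..d}" f] a b ab by simp
    have "(\<Sum>c=1..d. h' c) = (\<Sum>c=1..d. h c)"
      unfolding split2 using ab by (simp add: h'_def)
    then have pv: "prob_vector d h'" using h'0 h1 by (simp add: prob_vector_def)
    have "?S h' \<subseteq> ?S h" "a \<in> ?S h" "a \<notin> ?S h'"
      using a b ab by (auto simp: h'_def)
    then have "?S h' \<subset> ?S h" by blast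
    then have IH: "dominates d h' (uniform_vector d)"
      by (intro less.hyps pv psubset_card_mono) auto
    have "0 \<le> (h a - 1 / real d) * (1 / real d - h b)" using a b by simp
    then have prod: "h a * h b \<le> h' a * h' b" using ab by (simp add: h'_def algebra_simps)
    have "0 < 1 / real d" using assms(1) by simp
    then have pos: "0 < h a + h b" using a(2) h0[OF b(1)] by linarith
    have "dominates d h h'"
      by (rule dominates_transfer[OF h'0 a(1) b(1) ab _ _ pos prod]) (auto simp: h'_def ab)
    then show ?thesis using IH by (rule dominates_trans)
  qed
qed

section \<open>From return probabilities to the return time\<close>

definition returned :: "(nat \<times> bool) list \<Rightarrow> bool" where
  "returned xs \<longleftrightarrow> (\<exists>k\<in>{1..length xs}. balanced (take k xs))"

lemma balanced_Nil: "balanced []"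
  by (simp add: balanced_def)

lemma sum_step_weight:
  assumes "prob_vector d h"
  shows "sum (step_weight h) (dirs d) = 1"
proof -
  have "sum (step_weight h) (dirs d) = (\<Sum>c=1..d. \<Sum>sg\<in>UNIV. step_weight h (c, sg))"
    by (simp add: dirs_def sum.cartesian_product)
  then show ?thesis using assms by (simp add: prob_vector_def step_weight_def UNIV_bool)
qed

text \<open>
  Nonempty closed paths form a renewal process, whose first occurrences are the first returns.
\<close>

lemma renewal_equation:
  fixes d h
  defines "f \<equiv> \<lambda>k. walk_mass d h k (first (\<lambda>xs. xs \<noteq> [] \<and> balanced xs))"
  shows "return_gf d h = 1 + Abs_fps f * return_gf d h"
proof (rule fps_ext)
  fix n
  let ?E = "\<lambda>xs. xs \<noteq> [] \<and> balanced xs"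
  have dec: "walk_mass d h n ?E = (\<Sum>k\<le>n. f k * walk_mass d h (n - k) balanced)"
    unfolding f_def by (rule mass_first_decomposition) (auto simp: balanced_append)
  have "walk_mass d h n balanced = (1 :: real fps) $ n + walk_mass d h n ?E"
    by (cases n) (simp_all add: balanced_Nil)
  then show "return_gf d h $ n = (1 + Abs_fps f * return_gf d h) $ n"
    by (simp add: return_gf_def dec fps_mult_nth atMost_atLeast0)
qed

lemma first_returned: "first returned = first (\<lambda>xs. xs \<noteq> [] \<and> balanced xs)"
proof (rule ext, rule iffI)
  fix xs :: "(nat \<times> bool) list"
  assume fr: "first returned xs"
  then obtain k where k: "k \<in> {1..length xs}" "balanced (take k xs)"
    by (auto simp: first_def returned_def)
  have "k = length xs"
  proof (rule ccontr)
    assume "k \<noteq> length xs"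
    then have "k < length xs" using k by simp
    moreover from this have "returned (take k xs)"
      using k unfolding returned_def by (intro bexI[of _ k]) auto
    ultimately show False using fr by (simp add: first_def)
  qed
  moreover have "\<not> (take l xs \<noteq> [] \<and> balanced (take l xs))" if "l < length xs" for l
  proof
    assume l: "take l xs \<noteq> [] \<and> balanced (take l xs)"
    then have "returned (take l xs)"
      using that unfolding returned_def by (intro bexI[of _ l]) auto
    then show False using fr that by (simp add: first_def)
  qed
  ultimately show "first (\<lambda>xs. xs \<noteq> [] \<and> balanced xs) xs"
    using k by (auto simp: first_def)
next
  fix xs :: "(nat \<times> bool) list"
  assume fr: "first (\<lambda>xs. xs \<noteq> [] \<and> balanced xs) xs"
  then have "returned xs" unfolding returned_def
    by (intro bexI[of _ "length xs"]) (auto simp: first_def Suc_le_eq)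
  moreover have "\<not> returned (take l xs)" if l: "l < length xs" for l
  proof
    assume "returned (take l xs)"
    then obtain k where k: "k \<in> {1..l}" "balanced (take k xs)"
      using l by (auto simp: returned_def min_def)
    then have "k < length xs" "take k xs \<noteq> []" using l by auto
    then show False using fr k by (auto simp: first_def)
  qed
  ultimately show "first returned xs" by (simp add: first_def)
qed

lemma returned_append: "returned ys \<Longrightarrow> returned (ys @ zs)"
  unfolding returned_def by force

text \<open>
  Having returned is, once it has happened, preserved by every continuation; hence the decomposition at the first
  occurrence applies with the trivial predicate for the remainder.
\<close>

lemma walk_mass_returned:
  assumes "prob_vector d h"
  shows "walk_mass d h n returned = (\<Sum>k\<le>n. walk_mass d h k (first (\<lambda>xs. xs \<noteq> [] \<and> balanced xs)))"
proof -
  have "walk_mass d h n returned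
     = (\<Sum>k\<le>n. walk_mass d h k (first returned) * walk_mass d h (n - k) (\<lambda>_. True))"
    by (rule mass_first_decomposition) (simp add: returned_append)
  then show ?thesis by (simp add: first_returned mass_True[OF sum_step_weight[OF assms]])
qed

text \<open>
  With \<open>U\<close> the return series and \<open>F\<close> that of the first returns, \<open>1 - F = 1 / U\<close>; so \<open>U\<^bsub>h\<^esub> = U\<^bsub>h'\<^esub> K\<close> gives
  \<open>1 - F\<^bsub>h'\<^esub> = K (1 - F\<^bsub>h\<^esub>)\<close>. Partial summation of the coefficients yields the tails of the return times, all
  of them nonnegative, and the term with \<open>K\<^sub>0 = 1\<close> alone is the tail for \<open>h\<close>.
\<close>

lemma returned_mono:
  assumes pv: "prob_vector d h" "prob_vector d h'" and dom: "dominates d h h'"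
  shows "walk_mass d h' n returned \<le> walk_mass d h n returned"
proof -
  define F where "F g = Abs_fps (\<lambda>k. walk_mass d g k (first (\<lambda>xs. xs \<noteq> [] \<and> balanced xs)))" for g
  have F: "(1 - F g) * return_gf d g = 1" for g
    using renewal_equation[of d g] by (simp add: F_def algebra_simps)
  obtain K where K: "return_gf d h = return_gf d h' * K" "\<And>n. 0 \<le> K $ n"
    using dom unfolding dominates_def by blast
  have U0: "return_gf d g $ 0 = 1" for g by (simp add: return_gf_def balanced_Nil)
  have K0: "K $ 0 = 1" using arg_cong[OF K(1), of "\<lambda>f. f $ 0"] by (simp add: U0)
  have quot: "1 - F h' = K * (1 - F h)"
  proof -
    have "1 - F h' = (1 - F h') * ((1 - F h) * (return_gf d h' * K))" using F[of h] K(1) by simp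
    also have "\<dots> = ((1 - F h') * return_gf d h') * (K * (1 - F h))" by (simp add: mult_ac)
    finally show ?thesis by (simp add: F)
  qed
  \<comment> \<open>Multiplication by \<open>G = 1 / (1 - z)\<close> is partial summation of the coefficients.\<close>
  define G where "G = Abs_fps (\<lambda>_. 1 :: real)"
  have tail: "((1 - F g) * G) $ n = 1 - walk_mass d g n returned" if "prob_vector d g" for g n
    by (simp add: left_diff_distrib fps_mult_nth G_def F_def walk_mass_returned[OF that] atMost_atLeast0)
  have tail_nonneg: "0 \<le> ((1 - F h) * G) $ n" for n
  proof -
    have "walk_mass d h n returned \<le> walk_mass d h n (\<lambda>_. True)"
      using pv(1) by (intro mass_mono) (auto simp: step_weight_def prob_vector_def mem_dirs)
    then show ?thesis by (simp add: tail[OF pv(1)] mass_True[OF sum_step_weight[OF pv(1)]])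
  qed
  have "((1 - F h) * G) $ n \<le> (\<Sum>i=0..n. K $ i * ((1 - F h) * G) $ (n - i))"
    using member_le_sum[of 0 "{0..n}" "\<lambda>i. K $ i * ((1 - F h) * G) $ (n - i)"] K(2) tail_nonneg K0
    by simp
  also have "\<dots> = ((1 - F h') * G) $ n"
    unfolding quot mult.assoc by (rule fps_mult_nth[symmetric])
  finally show ?thesis by (simp add: tail pv)
qed

section \<open>The random walk and its lists of steps\<close>

definition step_vec :: "nat \<times> bool \<Rightarrow> nat \<Rightarrow> int" where
  "step_vec s = (if snd s then unit_vec (fst s) else (\<lambda>j. - unit_vec (fst s) j))"

lemma inj_step_vec: "inj step_vec"
proof (rule injI)
  fix s t assume eq: "step_vec s = step_vec t"
  show "s = t"
    using fun_cong[OF eq, of "fst s"]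
    by (cases s; cases t) (auto simp: step_vec_def unit_vec_def split: if_splits)
qed

lemma step_vec_in_lattice: "s \<in> dirs d \<Longrightarrow> step_vec s \<in> lattice d"
  by (auto simp: mem_dirs step_vec_def lattice_def unit_vec_def)

lemma sum_list_step_vec:
  "(\<Sum>s\<leftarrow>ys. step_vec s j) = int (count_list ys (j, True)) - int (count_list ys (j, False))"
  by (induction ys) (auto simp: step_vec_def unit_vec_def)

lemma walk_of_steps:
  assumes "\<And>l. l \<in> {1..k} \<Longrightarrow> X l \<omega> = step_vec (xs ! (l - 1))" and "k \<le> length xs"
  shows "walk X k \<omega> = zero_vec \<longleftrightarrow> balanced (take k xs)"
proof -
  have "walk X k \<omega> j = (\<Sum>s\<leftarrow>take k xs. step_vec s j)" for j
  proof -
    have "walk X k \<omega> j = (\<Sum>l=1..k. step_vec (xs ! (l - 1)) j)"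
      unfolding walk_def by (rule sum.cong) (use assms(1) in auto)
    also have "\<dots> = (\<Sum>l<k. step_vec (xs ! l) j)"
      by (simp add: sum.atLeast1_atMost_eq)
    also have "\<dots> = (\<Sum>s\<leftarrow>take k xs. step_vec s j)"
      using assms(2) by (simp add: sum_list_sum_nth lessThan_atLeast0)
    finally show ?thesis .
  qed
  then show ?thesis
    by (simp add: fun_eq_iff zero_vec_def sum_list_step_vec balanced_def)
qed

lemma return_time_le_iff:
  "return_time X \<omega> \<le> enat n \<longleftrightarrow> (\<exists>k\<in>{1..n}. walk X k \<omega> = zero_vec)"
proof
  let ?S = "{enat k | k. 1 \<le> k \<and> walk X k \<omega> = zero_vec}"
  assume le: "return_time X \<omega> \<le> enat n"
  have "?S \<noteq> {}"
  proof
    assume "?S = {}"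
    then have "return_time X \<omega> = Inf {}" by (simp only: return_time_def)
    then show False using le by (simp add: top_enat_def)
  qed
  then have "Inf ?S \<in> ?S" unfolding Inf_enat_def by (auto intro: LeastI)
  then show "\<exists>k\<in>{1..n}. walk X k \<omega> = zero_vec"
    using le by (auto simp: return_time_def)
next
  assume "\<exists>k\<in>{1..n}. walk X k \<omega> = zero_vec"
  then obtain k where "k \<in> {1..n}" "walk X k \<omega> = zero_vec" by blast
  then have "return_time X \<omega> \<le> enat k"
    unfolding return_time_def by (intro Inf_lower) auto
  also have "enat k \<le> enat n" using \<open>k \<in> {1..n}\<close> by simp
  finally show "return_time X \<omega> \<le> enat n" .
qed

lemma return_event_measurable:
  assumes "walk_increments M d h X"
  shows "{\<omega> \<in> space M. return_time X \<omega> \<le> enat n} \<in> sets M"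
proof -
  interpret prob_space M using assms by (simp add: walk_increments_def)
  have X: "X k \<in> measurable M (count_space (lattice d))" if "1 \<le> k" for k
    using assms that by (auto simp: walk_increments_def indep_vars_def)
  have coord: "(\<lambda>\<omega>. real_of_int (X k \<omega> j)) \<in> borel_measurable M" if "1 \<le> k" for k j
    by (rule measurable_compose[OF X[OF that]]) simp
  have sums: "(\<lambda>\<omega>. \<Sum>l=1..k. real_of_int (X l \<omega> j)) \<in> borel_measurable M" for k j
    by (rule borel_measurable_sum) (use coord in auto)
  have iff: "walk X k \<omega> = zero_vec \<longleftrightarrow> (\<forall>j. (\<Sum>l=1..k. real_of_int (X l \<omega> j)) = 0)" for k \<omega>
    by (simp add: walk_def zero_vec_def fun_eq_iff flip: of_int_sum)
  have "{\<omega> \<in> space M. \<forall>j. (\<Sum>l=1..k. real_of_int (X l \<omega> j)) = 0} \<in> sets M" for k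
    using sums by measurable
  then have "(\<Union>k\<in>{1..n}. {\<omega> \<in> space M. walk X k \<omega> = zero_vec}) \<in> sets M"
    by (intro sets.finite_UN) (auto simp: iff)
  also have "(\<Union>k\<in>{1..n}. {\<omega> \<in> space M. walk X k \<omega> = zero_vec})
      = {\<omega> \<in> space M. return_time X \<omega> \<le> enat n}"
    by (auto simp: return_time_le_iff)
  finally show ?thesis .
qed

text \<open>
  Prescribing the first steps one by one is an intersection of independent events. The empty list is
  treated separately, since independence speaks of nonempty index sets.
\<close>

lemma prob_steps:
  assumes wi: "walk_increments M d h X" and xs: "set xs \<subseteq> dirs d"
  defines "E \<equiv> {\<omega> \<in> space M. \<forall>k\<in>{1..length xs}. X k \<omega> = step_vec (xs ! (k - 1))}"
  shows "E \<in> sets M \<and> measure M E = prod_list (map (step_weight h) xs)"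
proof (cases "xs = []")
  case True
  then show ?thesis using wi by (auto simp: E_def walk_increments_def prob_space.prob_space)
next
  case False
  interpret prob_space M using wi by (simp add: walk_increments_def)
  let ?J = "{1..length xs}" and ?A = "\<lambda>k. {step_vec (xs ! (k - 1))}"
  have ind: "indep_vars (\<lambda>_. count_space (lattice d)) X {1..}"
    using wi by (simp add: walk_increments_def)
  have X: "X k \<in> measurable M (count_space (lattice d))" if "k \<in> ?J" for k
    using ind that by (auto simp: indep_vars_def)
  have mem: "xs ! (k - 1) \<in> dirs d" if "k \<in> ?J" for k
    using that xs by (intro subsetD[OF xs] nth_mem) auto
  have A: "?A k \<in> sets (count_space (lattice d))" if "k \<in> ?J" for k
    using step_vec_in_lattice[OF mem[OF that]] by simp
  have ne: "?J \<noteq> {}" using False by (cases xs) auto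
  have E: "E = (\<Inter>k\<in>?J. X k -` ?A k \<inter> space M)"
    using ne by (auto simp: E_def)
  have one: "prob (X k -` ?A k \<inter> space M) = step_weight h (xs ! (k - 1))" if k: "k \<in> ?J" for k
  proof -
    have "X k -` ?A k \<inter> space M = {\<omega> \<in> space M. X k \<omega> = step_vec (xs ! (k - 1))}" by auto
    moreover have "1 \<le> k" using k by simp
    ultimately show ?thesis
      using wi mem[OF k] by (auto simp: walk_increments_def step_weight_def step_vec_def mem_dirs)
  qed
  have "E \<in> events"
    unfolding E using ne by (intro sets.finite_INT measurable_sets[OF X] A) auto
  moreover have "prob E = (\<Prod>k\<in>?J. prob (X k -` ?A k \<inter> space M))"
    unfolding E by (rule indep_varsD[OF ind ne]) (use A in auto)
  moreover have "\<dots> = (\<Prod>k\<in>?J. step_weight h (xs ! (k - 1)))"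
    by (rule prod.cong) (simp_all only: one)
  moreover have "\<dots> = prod_list (map (step_weight h) xs)"
    by (simp add: prod.atLeast1_atMost_eq prod.list_conv_set_nth lessThan_atLeast0)
  ultimately show ?thesis by simp
qed

text \<open>
  Almost surely the first \<open>n\<close> increments form one of the lists of steps, because the probabilities of these
  disjoint events add up to \<open>1\<close>; on each of them the list decides whether the walk has returned.
\<close>

lemma return_probability:
  assumes wi: "walk_increments M d h X" and pv: "prob_vector d h"
  shows "measure M {\<omega> \<in> space M. return_time X \<omega> \<le> enat n} = walk_mass d h n returned"
proof -
  interpret prob_space M using wi by (simp add: walk_increments_def)
  define L where "L P = {xs. set xs \<subseteq> dirs d \<and> length xs = n \<and> P xs}" for P
  define E where "E xs = {\<omega> \<in> space M. \<forall>k\<in>{1..length xs}. X k \<omega> = step_vec (xs ! (k - 1))}" for xs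
  have finL: "finite (L P)" for P
    unfolding L_def by (rule finite_subset[OF _ finite_lists_length_eq[OF finite_dirs, of d n]]) auto
  have E: "E xs \<in> events" "prob (E xs) = prod_list (map (step_weight h) xs)" if "xs \<in> L P" for xs P
    using prob_steps[OF wi, of xs] that by (auto simp: L_def E_def)
  have disj: "disjoint_family_on E (L P)" for P
    unfolding disjoint_family_on_def
  proof (intro ballI impI)
    fix xs ys assume xy: "xs \<in> L P" "ys \<in> L P" "xs \<noteq> ys"
    then obtain i where i: "i < n" "xs ! i \<noteq> ys ! i" by (auto simp: L_def list_eq_iff_nth_eq)
    have "False" if "\<omega> \<in> E xs" "\<omega> \<in> E ys" for \<omega>
    proof -
      have "Suc i \<in> {1..length xs}" "Suc i \<in> {1..length ys}" using xy i by (auto simp: L_def)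
      then have "X (Suc i) \<omega> = step_vec (xs ! i)" "X (Suc i) \<omega> = step_vec (ys ! i)"
        using that by (force simp: E_def)+
      then show False using i(2) inj_step_vec by (simp add: inj_eq)
    qed
    then show "E xs \<inter> E ys = {}" by auto
  qed
  have union: "prob (\<Union>xs\<in>L P. E xs) = walk_mass d h n P" for P
  proof -
    have "prob (\<Union>xs\<in>L P. E xs) = (\<Sum>xs\<in>L P. prob (E xs))"
      by (rule finite_measure_finite_Union) (use finL E disj in auto)
    also have "\<dots> = walk_mass d h n P"
      by (simp add: E(2) mass_eq_sum_lists[OF finite_dirs] L_def)
    finally show ?thesis .
  qed
  let ?B = "{\<omega> \<in> space M. return_time X \<omega> \<le> enat n}" and ?G = "\<Union>xs\<in>L (\<lambda>_. True). E xs"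
  have G: "?G \<in> events" "prob ?G = 1"
    using finL E(1) by (auto simp: union mass_True[OF sum_step_weight[OF pv]] intro!: sets.finite_UN)
  have "AE \<omega> in M. \<omega> \<in> ?G" using G by (simp add: prob_eq_1)
  have on_E: "return_time X \<omega> \<le> enat n \<longleftrightarrow> returned xs" if "xs \<in> L P" "\<omega> \<in> E xs" for xs \<omega> P
  proof -
    have "walk X k \<omega> = zero_vec \<longleftrightarrow> balanced (take k xs)" if "k \<in> {1..n}" for k
      by (rule walk_of_steps) (use that \<open>xs \<in> L P\<close> \<open>\<omega> \<in> E xs\<close> in \<open>auto simp: L_def E_def\<close>)
    then show ?thesis
      using \<open>xs \<in> L P\<close> by (auto simp: return_time_le_iff returned_def L_def)
  qed
  have "prob ?B = prob (\<Union>xs\<in>L returned. E xs)"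
  proof (rule finite_measure_eq_AE)
    show "AE \<omega> in M. \<omega> \<in> ?B \<longleftrightarrow> \<omega> \<in> (\<Union>xs\<in>L returned. E xs)"
      using \<open>AE \<omega> in M. \<omega> \<in> ?G\<close>
    proof eventually_elim
      case (elim \<omega>)
      then obtain xs where xs: "xs \<in> L (\<lambda>_. True)" "\<omega> \<in> E xs" by blast
      have "\<omega> \<in> space M" using xs by (simp add: E_def)
      show ?case
      proof
        assume "\<omega> \<in> ?B"
        then have "xs \<in> L returned" using on_E[OF xs] xs(1) by (simp add: L_def)
        then show "\<omega> \<in> (\<Union>xs\<in>L returned. E xs)" using xs(2) by blast
      next
        assume "\<omega> \<in> (\<Union>xs\<in>L returned. E xs)"
        then obtain ys where ys: "ys \<in> L returned" "\<omega> \<in> E ys" by blast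
        have "return_time X \<omega> \<le> enat n" using on_E[OF ys] ys(1) by (simp add: L_def)
        then show "\<omega> \<in> ?B" using \<open>\<omega> \<in> space M\<close> by simp
      qed
    qed
  qed (use return_event_measurable[OF wi] finL E(1) in \<open>auto intro!: sets.finite_UN\<close>)
  then show ?thesis by (simp add: union)
qed

lemma walk_mass_pad_zero:
  assumes "h (Suc d) = 0"
  shows "walk_mass (Suc d) h n P = walk_mass d h n P"
proof (induction n arbitrary: P)
  case (Suc n)
  have "(\<Sum>s\<in>dirs (Suc d). step_weight h s * walk_mass d h n (\<lambda>xs. P (s # xs)))
      = (\<Sum>s\<in>dirs d. step_weight h s * walk_mass d h n (\<lambda>xs. P (s # xs)))"
    by (rule sum.mono_neutral_right) (auto simp: step_weight_def assms le_Suc_eq mem_dirs finite_dirs)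
  then show ?case by (simp add: Suc.IH)
qed simp

section \<open>The stochastic order of return times\<close>

theorem mainTheorem2:
  fixes M :: "'a measure" and N :: "'b measure"
  shows
    "(\<forall>d\<ge>1. \<forall>X Y.
        walk_increments M (d + 1) (uniform_vector (d + 1)) X \<longrightarrow>
        walk_increments N d (uniform_vector d) Y \<longrightarrow>
        (\<forall>n::nat. n \<ge> 1 \<longrightarrow>
          measure M {\<omega> \<in> space M. return_time X \<omega> \<le> enat n}
            \<le> measure N {\<omega> \<in> space N. return_time Y \<omega> \<le> enat n}))
     \<and>
     (\<forall>d\<ge>1. \<forall>h X Y.
        prob_vector d h \<longrightarrow>
        (\<exists>i\<in>{1..d}. h i \<noteq> uniform_vector d i) \<longrightarrow>
        walk_increments M d (uniform_vector d) X \<longrightarrow>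
        walk_increments N d h Y \<longrightarrow>
        (\<forall>n::nat. n \<ge> 1 \<longrightarrow>
          measure M {\<omega> \<in> space M. return_time X \<omega> \<le> enat n}
            \<le> measure N {\<omega> \<in> space N. return_time Y \<omega> \<le> enat n}))"
proof (intro conjI allI impI)
  fix d n :: nat and X Y
  assume d: "1 \<le> d" and X: "walk_increments M (d + 1) (uniform_vector (d + 1)) X"
    and Y: "walk_increments N d (uniform_vector d) Y"
  \<comment> \<open>The walk in dimension \<open>d\<close> is a walk in dimension \<open>d + 1\<close> that never moves along the last coordinate.\<close>
  define h where "h = (uniform_vector d)(Suc d := 0)"
  have "prob_vector (d + 1) h"
    using d by (simp add: prob_vector_def h_def uniform_vector_def)
  have "measure M {\<omega> \<in> space M. return_time X \<omega> \<le> enat n}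
      = walk_mass (d + 1) (uniform_vector (d + 1)) n returned"
    by (rule return_probability[OF X]) (simp add: prob_vector_uniform)
  also have "\<dots> \<le> walk_mass (d + 1) h n returned"
    using \<open>prob_vector (d + 1) h\<close>
    by (intro returned_mono dominates_uniform) (simp_all add: prob_vector_uniform)
  also have "\<dots> = walk_mass d h n returned"
    by (simp add: h_def walk_mass_pad_zero)
  also have "\<dots> = walk_mass d (uniform_vector d) n returned"
    by (rule mass_weight_cong) (auto simp: h_def step_weight_def mem_dirs)
  also have "\<dots> = measure N {\<omega> \<in> space N. return_time Y \<omega> \<le> enat n}"
    by (rule return_probability[OF Y, symmetric]) (simp add: prob_vector_uniform[OF d])
  finally show "measure M {\<omega> \<in> space M. return_time X \<omega> \<le> enat n}
      \<le> measure N {\<omega> \<in> space N. return_time Y \<omega> \<le> enat n}" .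
next
  fix d n :: nat and h X Y
  assume d: "1 \<le> d" and h: "prob_vector d h" and X: "walk_increments M d (uniform_vector d) X"
    and Y: "walk_increments N d h Y"
  have "walk_mass d (uniform_vector d) n returned \<le> walk_mass d h n returned"
    using d h by (intro returned_mono dominates_uniform prob_vector_uniform)
  then show "measure M {\<omega> \<in> space M. return_time X \<omega> \<le> enat n}
      \<le> measure N {\<omega> \<in> space N. return_time Y \<omega> \<le> enat n}"
    by (simp add: return_probability[OF X] return_probability[OF Y] prob_vector_uniform[OF d] h)
qed

end
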